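(* Let $\mathcal{D}$ be a design with $n$ points in the indeterminates $x_1,\dots,x_r$, where $x_i$ takes $n_i$ distinct values. Let $\alpha=(\alpha_1,\dots,\alpha_r)\in\mathbb{Z}_{\ge 0}^r$ be a monomial with $\alpha_i<n_i$ for $i=1,\dots,r$. A sufficient condition for $\alpha$ to be included in every leaf of the statistical fan of $\mathcal{D}$ is $n\ge G(\alpha)$, where $$G(\alpha)=\prod_{i=1}^r n_i-\prod_{i=1}^r (n_i-\alpha_i)+1.$$
   Context: A design $\mathcal{D}$ is a set of $n>1$ distinct points in $\mathbb{R}^r$, with coordinates (indeterminates) $x_1,\dots,x_r$, such that $x_j$ takes $n_j>1$ distinct values over the points of $\mathcal{D}$, for $j=1,\dots,r$. Let $(x_{i1},\dots,x_{ir})$ denote the $i$th point, $i=1,\dots,n$. A monomial is $x^\alpha = x_1^{\alpha_1}\cdots x_r^{\alpha_r}$ with $\alpha\in\mathbb{Z}_{\ge 0}^r$; it is identified with the $r$-tuple $\alpha$. The monomial vector $\mathbf{x}^\alpha\in\mathbb{R}^n$ of $\alpha$ has $i$th entry $\prod_{j=1}^r x_{ij}^{\alpha_j}$ (with $0^0=1$). A (polynomial) model with $p$ terms is $E[Y]=\sum_{k=1}^p \theta_{\alpha_k}x^{\alpha_k}$ with $\alpha_1,\dots,\alpha_p$ distinct monomials and unknown coefficients; it is determined by its set of monomials. It is identifiable from (supported by) $\mathcal{D}$ if the $n\times p$ model matrix with columns $\mathbf{x}^{\alpha_1},\dots,\mathbf{x}^{\alpha_p}$ has rank $p$. An identifiable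 model is saturated if $p=n$. A model is hierarchical if for every monomial $\alpha$ in the model, every $\beta\in\mathbb{Z}_{\ge 0}^r$ with $\beta_j\le\alpha_j$ for all $j$ is also in the model. A HIS model is one that is hierarchical, identifiable and saturated. The statistical fan of $\mathcal{D}$ is the set of all HIS models supported by $\mathcal{D}$; its members are called leaves. *)

theory Defs
  imports "Jordan_Normal_Form.DL_Rank"
begin

text \<open>
  Points of \<open>\<real>\<^sup>r\<close> are real vectors in \<open>carrier_vec r\<close>; monomials, i.e. exponent tuples in
  \<open>\<int>\<^sub>\<ge>\<^sub>0\<^sup>r\<close>, are natural-number vectors in \<open>carrier_vec r\<close>. Coordinates are numbered from 0.
\<close>

definition num_levels :: "real vec set \<Rightarrow> nat \<Rightarrow> nat" where
  "num_levels D j = card ((\<lambda>x. x $ j) ` D)"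

definition is_design :: "nat \<Rightarrow> real vec set \<Rightarrow> bool" where
  "is_design r D \<longleftrightarrow>
     finite D \<and> D \<subseteq> carrier_vec r \<and> card D > 1 \<and> (\<forall>j<r. num_levels D j > 1)"

definition monomial_value :: "nat vec \<Rightarrow> real vec \<Rightarrow> real" where
  "monomial_value \<alpha> x = (\<Prod>j<dim_vec \<alpha>. (x $ j) ^ (\<alpha> $ j))"

definition monomial_vector :: "real vec list \<Rightarrow> nat vec \<Rightarrow> real vec" where
  "monomial_vector ps \<alpha> = vec (length ps) (\<lambda>i. monomial_value \<alpha> (ps ! i))"

definition model_matrix :: "real vec list \<Rightarrow> nat vec list \<Rightarrow> real mat" where
  "model_matrix ps as = mat_of_cols (length ps) (map (monomial_vector ps) as)"

text \<open>
  The model matrix depends on a numbering of the points (rows) and of the monomials (columns), but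
  its rank does not, since renumbering only permutes rows and columns. So it is immaterial that
  the definition asks for some pair of numberings rather than for a given one. The existence of
  the list \<open>as\<close> also makes the model \<open>M\<close> finite.
\<close>

definition identifiable :: "real vec set \<Rightarrow> nat vec set \<Rightarrow> bool" where
  "identifiable D M \<longleftrightarrow>
     (\<exists>ps as. distinct ps \<and> set ps = D \<and> distinct as \<and> set as = M \<and>
        vec_space.rank (length ps) (model_matrix ps as) = length as)"

definition saturated :: "real vec set \<Rightarrow> nat vec set \<Rightarrow> bool" where
  "saturated D M \<longleftrightarrow> card M = card D"

definition hierarchical :: "nat \<Rightarrow> nat vec set \<Rightarrow> bool" where
  "hierarchical r M \<longleftrightarrow>
     (\<forall>\<alpha>\<in>M. \<forall>\<beta>\<in>carrier_vec r. (\<forall>j<r. \<beta> $ j \<le> \<alpha> $ j) \<longrightarrow> \<beta> \<in> M)"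

definition statistical_fan :: "nat \<Rightarrow> real vec set \<Rightarrow> nat vec set set" where
  "statistical_fan r D =
     {M. M \<subseteq> carrier_vec r \<and> hierarchical r M \<and> identifiable D M \<and> saturated D M}"

text \<open>Integer-valued, so that none of the subtractions is truncated.\<close>

definition G_bound :: "nat \<Rightarrow> real vec set \<Rightarrow> nat vec \<Rightarrow> int" where
  "G_bound r D \<alpha> =
     (\<Prod>i<r. int (num_levels D i)) - (\<Prod>i<r. int (num_levels D i) - int (\<alpha> $ i)) + 1"

end

theory Submission
  imports Defs
begin

text \<open>
  The bound is a counting statement about boxes of exponents. Let \<open>M\<close> be a leaf of the fan and
  let \<open>n\<^sub>i\<close> be the number of levels of the \<open>i\<close>-th coordinate.

  No member of \<open>M\<close> has an \<open>i\<close>-th exponent \<open>\<ge> n\<^sub>i\<close>: otherwise the hierarchical set \<open>M\<close> would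
  contain every power of \<open>x\<^sub>i\<close> from \<open>1\<close> up to the \<open>n\<^sub>i\<close>-th, whereas the monic polynomial of
  degree \<open>n\<^sub>i\<close> whose roots are the levels of the \<open>i\<close>-th coordinate is a linear relation among
  these monomials on the design, and the columns of an identifiable model are independent
  (\<open>leaf_exponent_less_num_levels\<close>). So \<open>M\<close> lies in the box \<open>\<Prod>\<^sub>i {0..<n\<^sub>i}\<close>.

  If \<open>\<alpha>\<close> is missing from \<open>M\<close>, then so is every monomial that \<open>\<alpha>\<close> divides, that is, \<open>M\<close> avoids
  the smaller box \<open>\<Prod>\<^sub>i {\<alpha>\<^sub>i..<n\<^sub>i}\<close>. Hence \<open>M\<close> has at most \<open>\<Prod>\<^sub>i n\<^sub>i - \<Prod>\<^sub>i (n\<^sub>i - \<alpha>\<^sub>i) = G(\<alpha>) - 1\<close>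
  elements. But a leaf is saturated, so it has as many elements as the design has points, which
  is at least \<open>G(\<alpha>)\<close>.
\<close>

text \<open>
  For a saturated model the model matrix is square, so that a linear relation among its columns
  makes the determinant vanish and the rank drop.
\<close>

lemma saturated_identifiable_independent:
  assumes "identifiable D M" "saturated D M"
    and rel: "\<And>x. x \<in> D \<Longrightarrow> (\<Sum>\<beta>\<in>M. monomial_value \<beta> x * c \<beta>) = 0"
    and "\<beta> \<in> M"
  shows "c \<beta> = 0"
proof (rule ccontr)
  assume "c \<beta> \<noteq> 0"
  from assms(1) obtain ps as where ps: "distinct ps" "set ps = D"
    and as: "distinct as" "set as = M"
    and rank: "vec_space.rank (length ps) (model_matrix ps as) = length as"
    unfolding identifiable_def by blast
  define n where "n = length ps"
  have len: "length as = n"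
    using assms(2) ps as distinct_card unfolding saturated_def n_def by metis
  define A where "A = model_matrix ps as"
  have A: "A \<in> carrier_mat n n"
    unfolding A_def model_matrix_def n_def using len n_def by (simp add: mat_of_cols_def)
  define v where "v = vec n (\<lambda>j. c (as ! j))"
  have v: "v \<in> carrier_vec n" by (simp add: v_def)
  obtain k where k: "k < n" "as ! k = \<beta>"
    using \<open>\<beta> \<in> M\<close> as(2) len by (metis in_set_conv_nth)
  have "v $ k \<noteq> 0" using k \<open>c \<beta> \<noteq> 0\<close> by (simp add: v_def)
  then have "v \<noteq> 0\<^sub>v n" using k by auto
  moreover have "A *\<^sub>v v = 0\<^sub>v n"
  proof (rule eq_vecI)
    fix i assume "i < dim_vec (0\<^sub>v n :: real vec)"
    then have i: "i < n" by simp
    have entry: "A $$ (i, j) = monomial_value (as ! j) (ps ! i)" if "j < n" for j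
      using that i len
      by (simp add: A_def model_matrix_def mat_of_cols_def monomial_vector_def n_def)
    have "(A *\<^sub>v v) $ i = (\<Sum>j<n. monomial_value (as ! j) (ps ! i) * c (as ! j))"
      using A i by (simp add: scalar_prod_def v_def entry atLeast0LessThan)
    also have "\<dots> = (\<Sum>\<beta>\<in>M. monomial_value \<beta> (ps ! i) * c \<beta>)"
      by (rule sum.reindex_bij_betw) (use bij_betw_nth[OF as(1)] as(2) len in auto)
    also have "\<dots> = 0" using i ps(2) by (intro rel) (auto simp: n_def)
    finally show "(A *\<^sub>v v) $ i = 0\<^sub>v n $ i" using i by simp
  qed (use A in simp)
  ultimately have "det A = 0" using det_0_iff_vec_prod_zero_field[OF A] v by blast
  then have "vec_space.rank n A < n" by (rule vec_space.det_zero_low_rank[OF A])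
  then show False using rank len by (simp add: A_def n_def)
qed

definition pure_power :: "nat \<Rightarrow> nat \<Rightarrow> nat \<Rightarrow> nat vec" where
  "pure_power r i k = vec r (\<lambda>j. if j = i then k else 0)"

lemma monomial_value_pure_power:
  assumes "i < r"
  shows "monomial_value (pure_power r i k) x = (x $ i) ^ k"
proof -
  have "monomial_value (pure_power r i k) x = (\<Prod>j<r. if j = i then (x $ i) ^ k else 1)"
    unfolding monomial_value_def pure_power_def by (intro prod.cong) auto
  also have "\<dots> = (x $ i) ^ k" using assms by (subst prod.delta) auto
  finally show ?thesis .
qed

lemma inj_pure_power:
  assumes "i < r"
  shows "inj (pure_power r i)"
proof (rule injI)
  fix k l assume "pure_power r i k = pure_power r i l"
  then have "pure_power r i k $ i = pure_power r i l $ i" by simp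
  then show "k = l" using assms by (simp add: pure_power_def)
qed

text \<open>
  The polynomial that vanishes at every level of the \<open>i\<close>-th coordinate is a linear relation among
  the powers of \<open>x\<^sub>i\<close> below \<open>\<beta>\<close>; it is nontrivial because it is monic.
\<close>

lemma leaf_exponent_less_num_levels:
  assumes "is_design r D" "M \<in> statistical_fan r D" "\<beta> \<in> M" "i < r"
  shows "\<beta> $ i < num_levels D i"
proof (rule ccontr)
  assume "\<not> \<beta> $ i < num_levels D i"
  then have ge: "num_levels D i \<le> \<beta> $ i" by simp
  define m where "m = num_levels D i"
  define p where "p = (\<Prod>t\<in>(\<lambda>x. x $ i) ` D. [:-t, 1:])"
  have fin: "finite D" using assms(1) by (simp add: is_design_def)
  have deg: "degree p = m"
    unfolding p_def by (subst degree_prod_sum_eq) (auto simp: m_def num_levels_def)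
  have M: "hierarchical r M" "identifiable D M" "saturated D M"
    using assms(2) by (auto simp: statistical_fan_def)
  have in_M: "pure_power r i k \<in> M" if "k \<le> m" for k
  proof -
    have "\<forall>j<r. pure_power r i k $ j \<le> \<beta> $ j"
      using that ge by (auto simp: pure_power_def m_def)
    then show ?thesis
      using M(1) assms(3) unfolding hierarchical_def by (auto simp: pure_power_def)
  qed
  have finM: "finite M" using M(2) by (auto simp: identifiable_def)
  \<comment> \<open>The coefficients of \<open>p\<close>, transported to the exponent vectors of the powers of \<open>x\<^sub>i\<close>.\<close>
  define c where "c \<beta> = (if \<beta> \<in> pure_power r i ` {..m} then coeff p (\<beta> $ i) else 0)" for \<beta>
  have c: "c (pure_power r i k) = coeff p k" if "k \<le> m" for k
    using that assms(4) by (auto simp: c_def) (simp_all add: pure_power_def)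
  have "(\<Sum>\<beta>\<in>M. monomial_value \<beta> x * c \<beta>) = 0" if x: "x \<in> D" for x
  proof -
    have "(\<Sum>\<beta>\<in>M. monomial_value \<beta> x * c \<beta>)
        = (\<Sum>\<beta>\<in>pure_power r i ` {..m}. monomial_value \<beta> x * c \<beta>)"
      using finM in_M by (intro sum.mono_neutral_right) (auto simp: c_def)
    also have "\<dots> = (\<Sum>k\<le>m. (x $ i) ^ k * coeff p k)"
      using inj_pure_power[OF assms(4)] monomial_value_pure_power[OF assms(4)] c
      by (subst sum.reindex) (auto intro: inj_on_subset)
    also have "\<dots> = poly p (x $ i)"
      by (simp add: poly_altdef deg mult.commute)
    also have "\<dots> = 0"
      using x fin by (auto simp: p_def poly_prod)
    finally show ?thesis .
  qed
  then have "c (pure_power r i m) = 0"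
    using saturated_identifiable_independent[OF M(2,3)] in_M by blast
  moreover have "lead_coeff p = 1" by (simp add: p_def lead_coeff_prod)
  ultimately show False using c[of m] deg by simp
qed

lemma bij_betw_vec_box:
  "bij_betw (\<lambda>f. vec r f) (Pi\<^sub>E {..<r} S) {\<beta> \<in> carrier_vec r. \<forall>i<r. \<beta> $ i \<in> S i}"
  by (rule bij_betw_byWitness[where f' = "\<lambda>\<beta>. restrict (vec_index \<beta>) {..<r}"])
     (auto simp: PiE_def extensional_def fun_eq_iff split: if_splits)

lemma card_vec_box:
  "card {\<beta> \<in> carrier_vec r. \<forall>i<r. \<beta> $ i \<in> S i} = (\<Prod>i<r. card (S i))"
  using bij_betw_same_card[OF bij_betw_vec_box[of r S]] by (simp add: card_PiE)

lemma finite_vec_box: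
  assumes "\<And>i. i < r \<Longrightarrow> finite (S i)"
  shows "finite {\<beta> \<in> carrier_vec r. \<forall>i<r. \<beta> $ i \<in> S i}"
  using assms by (intro iffD1[OF bij_betw_finite[OF bij_betw_vec_box]] finite_PiE) auto

theorem theorem4p8:
  fixes r :: nat and D :: "real vec set" and \<alpha> :: "nat vec"
  assumes "is_design r D"
    and "\<alpha> \<in> carrier_vec r"
    and "\<forall>i<r. \<alpha> $ i < num_levels D i"
    and "int (card D) \<ge> G_bound r D \<alpha>"
  shows "\<forall>M\<in>statistical_fan r D. \<alpha> \<in> M"
proof (intro ballI, rule ccontr)
  fix M assume M: "M \<in> statistical_fan r D" and "\<alpha> \<notin> M"
  let ?n = "num_levels D"
  define B where "B = {\<beta> \<in> carrier_vec r. \<forall>i<r. \<beta> $ i \<in> {0..<?n i}}"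
  define U where "U = {\<beta> \<in> carrier_vec r. \<forall>i<r. \<beta> $ i \<in> {\<alpha> $ i..<?n i}}"
  have fin: "finite B" unfolding B_def by (rule finite_vec_box) simp
  have "U \<subseteq> B" by (auto simp: U_def B_def)
  have "M \<subseteq> B"
    using M leaf_exponent_less_num_levels[OF assms(1) M]
    by (auto simp: B_def statistical_fan_def)
  moreover have "M \<inter> U = {}"
  proof -
    have "\<alpha> \<in> M" if "\<beta> \<in> M" "\<beta> \<in> U" for \<beta>
    proof -
      have "\<forall>j<r. \<alpha> $ j \<le> \<beta> $ j" using that(2) by (auto simp: U_def)
      then show ?thesis
        using M that(1) assms(2) by (simp add: statistical_fan_def hierarchical_def)
    qed
    then show ?thesis using \<open>\<alpha> \<notin> M\<close> by blast
  qed
  ultimately have "card M \<le> card (B - U)"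
    using fin by (intro card_mono) auto
  also have "\<dots> = card B - card U"
    using fin \<open>U \<subseteq> B\<close> by (simp add: card_Diff_subset finite_subset)
  finally have "int (card M) \<le> int (card B) - int (card U)"
    using card_mono[OF fin \<open>U \<subseteq> B\<close>] by linarith
  moreover have "int (card B) = (\<Prod>i<r. int (?n i))"
    unfolding B_def card_vec_box by simp
  moreover have "int (card U) = (\<Prod>i<r. int (?n i) - int (\<alpha> $ i))"
    unfolding U_def card_vec_box of_nat_prod
    using assms(3) by (intro prod.cong) (auto simp: of_nat_diff)
  moreover have "card M = card D"
    using M by (simp add: statistical_fan_def saturated_def)
  ultimately show False using assms(4) by (simp add: G_bound_def)
qed

end
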